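(* Let $n$ be a positive integer with prime factorization \[ n=3^{a}5^{b}\prod_{i=1}^{r}p_i^{v_i}\prod_{j=1}^{s}q_j^{w_j}, \] where each $p_i\equiv 1\pmod 3$ and each $q_j\neq 5$ satisfies $q_j\equiv 2\pmod 3$. Define $\Lambda(n)=\prod_{i=1}^{r}(1+v_i)\prod_{j=1}^{s}\frac{1+(-1)^{w_j}}{2}$, and let $t$ be the number of prime factors of $n$, counted with multiplicity, that are congruent to $7$ or $13\pmod{15}$. Then \[ (1,1,19;n)=\begin{cases}(1+(-1)^{a+t})\Lambda(n), & b=0,\\ 0, & b \text{ odd},\\ 6\Lambda(n), & b>0,\ b \text{ even},\end{cases} \qquad (3,3,7;n)=\begin{cases}(1-(-1)^{a+t})\Lambda(n), & b=0,\\ 0, & b \text{ odd},\\ 6\Lambda(n), & b>0,\ b \text{ even}.\end{cases} \]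
   Context: For a binary quadratic form $(a,b,c)$, i.e. $ax^2+bxy+cy^2$, the quantity $(a,b,c;n)$ denotes the number of pairs $(x,y)\in\mathbb{Z}^2$ with $ax^2+bxy+cy^2=n$. *)

theory Defs
  imports Complex_Main "HOL-Number_Theory.Number_Theory"
begin

text \<open>
  The number of integral representations of \<open>n\<close> by the form \<open>(a, b, c)\<close>. The set below is
  finite for positive definite forms; for an infinite set \<open>card\<close> would return the junk value 0.
\<close>

definition num_reps :: "int \<Rightarrow> int \<Rightarrow> int \<Rightarrow> nat \<Rightarrow> nat" where
  "num_reps a b c n = card {(x :: int, y :: int). a * x^2 + b * x * y + c * y^2 = int n}"

definition Lam :: "nat \<Rightarrow> real" where
  "Lam n =
     (\<Prod>p\<in>{p \<in> prime_factors n. [p = 1] (mod 3)}. 1 + real (multiplicity p n)) *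
     (\<Prod>q\<in>{q \<in> prime_factors n. q \<noteq> 5 \<and> [q = 2] (mod 3)}. (1 + (-1) ^ multiplicity q n) / 2)"

definition num_pf_7_13 :: "nat \<Rightarrow> nat" where
  "num_pf_7_13 n =
     size {# p \<in># prime_factorization n. [p = 7] (mod 15) \<or> [p = 13] (mod 15) #}"

end

theory Submission
  imports Defs "HOL-Library.Discrete_Functions"
begin

text \<open>
  Both forms have discriminant \<open>-75\<close> and reduce to the norm form \<open>u\<^sup>2 + u v + v\<^sup>2\<close> of the
  Eisenstein integers: \<open>(1,1,19)\<close> is its restriction to the sublattice \<open>5 | v\<close>, and
  \<open>(3,3,7; n) = (1,1,19; 3n)\<close>. Let \<open>A(n)\<close> be the number of representations of \<open>n\<close> by the norm
  form. Then \<open>A(3n) = A(n)\<close>; a prime \<open>q \<equiv> 2 (mod 3)\<close> dividing a norm divides both coordinates;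
  and a prime \<open>p \<equiv> 1 (mod 3)\<close> splits as a product of conjugate elements, so that
  inclusion-exclusion gives \<open>A(pn) = 2 A(n) - A(n/p)\<close>. Together these evaluate \<open>A\<close>.

  If \<open>5 | n\<close>, the condition \<open>5 | v\<close> is automatic. Otherwise the sixth roots of unity permute the
  conditions \<open>5 | u\<close>, \<open>5 | v\<close>, \<open>5 | u + v\<close>; exactly one of them holds if \<open>n\<close> is a square mod 5,
  and none holds if it is not. Hence \<open>(1,1,19; n)\<close> is \<open>A(n) / 3\<close> or \<open>0\<close>, according to the
  quadratic character of \<open>n\<close> mod 5, which equals \<open>(-1)\<^bsup>a+t\<^esup>\<close> whenever \<open>Lam n \<noteq> 0\<close>.
\<close>

section \<open>The Eisenstein norm equation: finiteness, units, factors 3 and p^2\<close>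

definition eis_reps :: "nat \<Rightarrow> (int \<times> int) set" where
  "eis_reps n = {(x, y). x\<^sup>2 + x * y + y\<^sup>2 = int n}"

lemma eis_reps_iff: "(x, y) \<in> eis_reps n \<longleftrightarrow> x\<^sup>2 + x * y + y\<^sup>2 = int n"
  by (simp add: eis_reps_def)

lemma finite_eis_reps: "finite (eis_reps n)"
proof -
  have "eis_reps n \<subseteq> {-4 * int n..4 * int n} \<times> {-4 * int n..4 * int n}"
  proof
    fix z assume z: "z \<in> eis_reps n"
    obtain x y where [simp]: "z = (x, y)" by (cases z)
    have e: "x\<^sup>2 + x * y + y\<^sup>2 = int n" using z by (simp add: eis_reps_iff)
    \<comment> \<open>Four times the norm, with the square completed in either variable, bounds both
      coordinates.\<close>
    have "(2 * x + y)\<^sup>2 + 3 * y\<^sup>2 = 4 * int n" "(x + 2 * y)\<^sup>2 + 3 * x\<^sup>2 = 4 * int n"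
      using e by (simp_all add: power2_eq_square algebra_simps)
    moreover have "(2 * x + y)\<^sup>2 \<ge> 0" "(x + 2 * y)\<^sup>2 \<ge> 0" by simp_all
    moreover have "\<bar>x\<bar> \<le> x\<^sup>2" "\<bar>y\<bar> \<le> y\<^sup>2"
      by (metis abs_le_square_iff abs_ge_zero abs_power2 int_one_le_iff_zero_less linorder_not_less
          mult_right_mono mult_1 order_le_less power2_abs power2_eq_square zero_less_abs_iff)+
    moreover have "x\<^sup>2 \<ge> 0" "y\<^sup>2 \<ge> 0" by simp_all
    ultimately have "\<bar>x\<bar> \<le> 4 * int n" "\<bar>y\<bar> \<le> 4 * int n" by linarith+
    thus "z \<in> {-4 * int n..4 * int n} \<times> {-4 * int n..4 * int n}" by auto
  qed
  thus ?thesis by (rule finite_subset) simp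
qed

text \<open>The six solutions are the units of the Eisenstein integers, the source of the factor 6
  in the final formulas.\<close>

lemma card_eis_reps_1: "card (eis_reps 1) = 6"
proof -
  have "eis_reps 1 = {(1,0), (-1,0), (0,1), (0,-1), (1,-1), (-1,1)}" (is "_ = ?S")
  proof (intro equalityI subsetI)
    fix z assume z: "z \<in> eis_reps 1"
    obtain x y where [simp]: "z = (x, y)" by (cases z)
    have e: "x\<^sup>2 + x * y + y\<^sup>2 = 1" using z by (simp add: eis_reps_iff)
    have 1: "(2 * x + y)\<^sup>2 + 3 * y\<^sup>2 = 4" "(x + 2 * y)\<^sup>2 + 3 * x\<^sup>2 = 4"
      using e by (simp_all add: power2_eq_square algebra_simps)
    have "\<bar>w\<bar> < 2" if "v\<^sup>2 + 3 * w\<^sup>2 = 4" for v w :: int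
    proof (rule ccontr)
      assume "\<not> ?thesis"
      hence "2\<^sup>2 \<le> w\<^sup>2" using abs_le_square_iff[of 2 w] by linarith
      thus False using that zero_le_power2[of v] by simp
    qed
    with 1 have "\<bar>x\<bar> < 2" "\<bar>y\<bar> < 2" by blast+
    hence "x \<in> {-1, 0, 1}" "y \<in> {-1, 0, 1}" by auto
    with e show "z \<in> ?S" by auto
  qed (auto simp: eis_reps_iff)
  thus ?thesis by simp
qed

text \<open>The bijection is multiplication by \<open>1 + \<zeta>\<close>, an element of norm 3,
  where \<open>\<zeta>\<^sup>2 = \<zeta> - 1\<close>. It is onto because the norm is congruent to
  \<open>(u - v)\<^sup>2\<close> modulo 3, which forces u and v to be congruent.\<close>

lemma card_eis_reps_3_mult: "card (eis_reps (3 * n)) = card (eis_reps n)"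
proof -
  have "bij_betw (\<lambda>(x, y). (x - y, x + 2 * y)) (eis_reps n) (eis_reps (3 * n))"
  proof (rule bij_betwI[where g = "\<lambda>(u, v). ((2 * u + v) div 3, (v - u) div 3)"])
    show "(\<lambda>(x, y). (x - y, x + 2 * y)) \<in> eis_reps n \<rightarrow> eis_reps (3 * n)"
      by (auto simp: eis_reps_iff power2_eq_square algebra_simps)
  next
    have 3: "\<exists>x y. u = x - y \<and> v = x + 2 * y \<and> (x, y) \<in> eis_reps n"
      if "(u, v) \<in> eis_reps (3 * n)" for u v
    proof -
      have e: "u\<^sup>2 + u * v + v\<^sup>2 = 3 * int n" using that by (simp add: eis_reps_iff)
      hence "(u - v)\<^sup>2 = 3 * (int n - u * v)" by (simp add: power2_eq_square algebra_simps)
      hence "3 dvd (u - v)\<^sup>2" by simp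
      hence "3 dvd u - v" by (rule prime_dvd_power[rotated]) simp
      then obtain k where k: "u = v + 3 * k" by (metis dvd_def add.commute diff_add_cancel)
      have "3 * ((v + 2 * k)\<^sup>2 + (v + 2 * k) * (-k) + (-k)\<^sup>2) = 3 * int n"
        using e unfolding k by (simp add: power2_eq_square algebra_simps)
      hence "(v + 2 * k, -k) \<in> eis_reps n" by (simp add: eis_reps_iff)
      moreover have "u = (v + 2 * k) - (-k)" "v = (v + 2 * k) + 2 * (-k)" using k by simp_all
      ultimately show ?thesis by blast
    qed
    show "(\<lambda>(u, v). ((2 * u + v) div 3, (v - u) div 3)) \<in> eis_reps (3 * n) \<rightarrow> eis_reps n"
    proof (clarify)
      fix u v assume "(u, v) \<in> eis_reps (3 * n)"
      from 3[OF this] show "((2 * u + v) div 3, (v - u) div 3) \<in> eis_reps n"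
        by (auto simp: algebra_simps)
    qed
    fix z assume "z \<in> eis_reps (3 * n)"
    thus "(\<lambda>(x, y). (x - y, x + 2 * y)) ((\<lambda>(u, v). ((2 * u + v) div 3, (v - u) div 3)) z) = z"
      using 3 by (cases z) (fastforce simp: algebra_simps)
  qed (auto simp: algebra_simps)
  thus ?thesis by (simp add: bij_betw_same_card)
qed

text \<open>Removes a factor \<open>p\<^sup>2\<close>. For an inert prime these are all the
  solutions; for a split prime they form the overlap in the inclusion-exclusion.\<close>

lemma card_eis_reps_scaled:
  assumes "p > 0"
  shows "card {(x, y) \<in> eis_reps (p\<^sup>2 * n). int p dvd x \<and> int p dvd y} = card (eis_reps n)"
proof -
  have *: "(int p * x)\<^sup>2 + (int p * x) * (int p * y) + (int p * y)\<^sup>2 =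
      (int p)\<^sup>2 * (x\<^sup>2 + x * y + y\<^sup>2)" for x y
    by (simp add: power2_eq_square algebra_simps)
  have "{(x, y) \<in> eis_reps (p\<^sup>2 * n). int p dvd x \<and> int p dvd y} =
      (\<lambda>(x, y). (int p * x, int p * y)) ` eis_reps n"
    using assms by (auto simp: eis_reps_iff * dvd_def image_iff)
  moreover have "inj_on (\<lambda>(x, y). (int p * x, int p * y)) (eis_reps n)"
    using assms by (auto simp: inj_on_def)
  ultimately show ?thesis by (simp add: card_image)
qed

section \<open>Inert primes, congruent to 2 modulo 3\<close>

text \<open>The norm divides \<open>x ^ 3 - y ^ 3\<close>, and cubing is injective on the units
  modulo q because 3 does not divide q - 1. So if q does not divide x, then x and y are congruent,
  whence q divides \<open>3 * x\<^sup>2\<close>, which is impossible.\<close>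

lemma inert_prime_dvd:
  fixes x y :: int
  assumes q: "prime q" "[q = 2] (mod 3)" and d: "int q dvd x\<^sup>2 + x * y + y\<^sup>2"
  shows "int q dvd x \<and> int q dvd y"
proof -
  have pq: "prime (int q)" using q by simp
  have fermat: "[z ^ (q - 1) = 1] (mod int q)" if "\<not> int q dvd z" for z :: int
  proof -
    have "[nat (z mod int q) ^ (q - 1) = 1] (mod q)"
    proof (rule fermat_theorem)
      show "\<not> q dvd nat (z mod int q)"
        using that q by (metis dvd_mod_iff dvd_refl int_dvd_int_iff int_nat_eq of_nat_0 of_nat_0_less_iff 
           pos_mod_sign prime_gt_0_nat int_nat_eq)
    qed fact
    hence "[int (nat (z mod int q) ^ (q - 1)) = int 1] (mod int q)" by (simp only: cong_int_iff)
    moreover have "int (nat (z mod int q)) = z mod int q" using q prime_gt_0_nat by simp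
    ultimately have "[(z mod int q) ^ (q - 1) = 1] (mod int q)" by simp
    thus ?thesis by (simp add: cong_def power_mod)
  qed
  have one: "int q dvd x" if "int q dvd y" 
  proof -
    have "x\<^sup>2 = (x\<^sup>2 + x * y + y\<^sup>2) - y * (x + y)" by (simp add: power2_eq_square algebra_simps)
    hence "int q dvd x\<^sup>2" using that d by (metis dvd_diff dvd_mult2)
    thus ?thesis using pq prime_dvd_power by blast
  qed
  have two: "int q dvd y" if "int q dvd x" 
  proof -
    have "y\<^sup>2 = (x\<^sup>2 + x * y + y\<^sup>2) - x * (x + y)" by (simp add: power2_eq_square algebra_simps)
    hence "int q dvd y\<^sup>2" using that d by (metis dvd_diff dvd_mult2)
    thus ?thesis using pq prime_dvd_power by blast
  qed
  have "int q dvd x"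
  proof (rule ccontr)
    assume nx: "\<not> int q dvd x"
    hence ny: "\<not> int q dvd y" using one by blast
    obtain k where k: "q - 1 = 3 * k + 1"
    proof -
      have "q mod 3 = 2" using q by (simp add: cong_def)
      hence "q - 1 = 3 * (q div 3) + 1" by presburger
      thus ?thesis by (rule that)
    qed
    have "x ^ 3 - y ^ 3 = (x - y) * (x\<^sup>2 + x * y + y\<^sup>2)"
      by (simp add: power2_eq_square power3_eq_cube algebra_simps)
    hence c: "[x ^ 3 = y ^ 3] (mod int q)" using d by (simp add: cong_iff_dvd_diff)
    \<comment> \<open>Fermat's theorem with q - 1 = 3k + 1 exhibits x and y as inverses of their
      powers with exponent 3k, and these powers agree modulo q.\<close>
    have "[(x ^ 3) ^ k * x = 1] (mod int q)" "[(y ^ 3) ^ k * y = 1] (mod int q)"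
      using fermat[OF nx] fermat[OF ny] unfolding k power_add power_mult by simp_all
    moreover have "[(x ^ 3) ^ k = (y ^ 3) ^ k] (mod int q)" using c by (rule cong_pow)
    ultimately have 1: "[(x ^ 3) ^ k * x = (x ^ 3) ^ k * y] (mod int q)"
      by (meson cong_scalar_right cong_sym cong_trans)
    have "coprime ((x ^ 3) ^ k) (int q)"
      using nx pq by (meson coprime_commute coprime_power_right_iff prime_imp_coprime coprime_power_left_iff)
    with 1 have "[x = y] (mod int q)" using cong_mult_lcancel by blast
    hence xy: "int q dvd x - y" by (simp add: cong_iff_dvd_diff)
    have "3 * x\<^sup>2 = (x\<^sup>2 + x * y + y\<^sup>2) + (x - y) * (2 * x + y)" by (simp add: power2_eq_square algebra_simps)
    hence "int q dvd 3 * x\<^sup>2" using xy d by (metis dvd_add dvd_mult2)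
    hence "int q dvd 3" using nx pq by (metis prime_dvd_mult_iff prime_dvd_power)
    hence "q dvd 3" by presburger
    hence "q = 3" using q(1) primes_dvd_imp_eq[of q 3] by simp
    thus False using q by (simp add: cong_def)
  qed
  thus ?thesis using two by blast
qed

text \<open>All solutions for exponent j + 2 are divisible by q, so dividing by q lowers the
  exponent by two. At exponent 1 the same division would give q dividing m, so there are no
  solutions.\<close>

lemma card_eis_reps_inert:
  assumes q: "prime q" "[q = 2] (mod 3)" and m: "\<not> q dvd m"
  shows "card (eis_reps (q ^ k * m)) = (if even k then card (eis_reps m) else 0)"
proof (induction k rule: less_induct)
  case (less k)
  consider "k = 0" | "k = 1" | j where "k = j + 2" 
    by (metis One_nat_def add_2_eq_Suc' not0_implies_Suc)
  thus ?case
  proof cases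
    case 2
    have "eis_reps (q * m) = {}"
    proof (rule ccontr)
      assume "eis_reps (q * m) \<noteq> {}"
      then obtain x y where xy: "x\<^sup>2 + x * y + y\<^sup>2 = int (q * m)" by (auto simp: eis_reps_def)
      hence "int q dvd x \<and> int q dvd y" using inert_prime_dvd[OF q, of x y] by simp
      then obtain u v where [simp]: "x = int q * u" "y = int q * v" by (auto simp: dvd_def)
      have "int q * (int q * (u\<^sup>2 + u * v + v\<^sup>2)) = int q * int m"
        using xy by (simp add: power2_eq_square algebra_simps)
      hence "int q * (u\<^sup>2 + u * v + v\<^sup>2) = int m" using q by simp
      hence "int q dvd int m" by (metis dvd_triv_left)
      with m show False by simp
    qed
    thus ?thesis using 2 by simp
  next
    case 3
    have e: "q ^ k * m = q\<^sup>2 * (q ^ j * m)" using 3 by (simp add: power2_eq_square)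
    have "int q dvd x \<and> int q dvd y" if "(x, y) \<in> eis_reps (q\<^sup>2 * (q ^ j * m))" for x y
      by (rule inert_prime_dvd[OF q]) (use that in \<open>simp add: eis_reps_iff\<close>)
    hence "eis_reps (q ^ k * m) = {(x, y) \<in> eis_reps (q\<^sup>2 * (q ^ j * m)). int q dvd x \<and> int q dvd y}"
      unfolding e by auto
    hence "card (eis_reps (q ^ k * m)) = card (eis_reps (q ^ j * m))"
      using q by (simp add: card_eis_reps_scaled prime_gt_0_nat)
    thus ?thesis using less[of j] 3 by simp
  qed auto
qed

section \<open>Split primes, congruent to 1 modulo 3\<close>

text \<open>A primitive root raised to the power (p - 1) / 3 has cube 1 but is not 1 itself, so p
  divides the quadratic factor of \<open>h ^ 3 - 1\<close>.\<close>

lemma ex_cube_root_of_unity: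
  assumes p: "prime p" "[p = 1] (mod 3)"
  shows "\<exists>z. int p dvd z\<^sup>2 + z + 1"
proof -
  obtain g where g: "residue_primroot p g" using prime_primitive_root_exists[of p] p prime_gt_1_nat by auto
  have p2: "p > 1" using p prime_gt_1_nat by simp
  have ord_g: "ord p g = p - 1" using g p by (simp add: residue_primroot_def totient_prime)
  obtain k where k: "p - 1 = 3 * k"
  proof -
    have "p mod 3 = 1" using p by (simp add: cong_def)
    hence "p - 1 = 3 * (p div 3)" by presburger
    thus ?thesis by (rule that)
  qed
  have kpos: "k > 0" using k p2 by auto
  have 3: "[g ^ (3 * k) = 1] (mod p)" using ord[of g p] ord_g k by simp
  have 1: "\<not> [g ^ k = 1] (mod p)"
  proof
    assume "[g ^ k = 1] (mod p)"
    hence "ord p g dvd k" by (simp only: ord_divides)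
    thus False using ord_g k kpos by (auto dest: dvd_imp_le)
  qed
  define h where "h = int (g ^ k)"
  have "[int (g ^ (3 * k)) = int 1] (mod int p)" using 3 by (simp only: cong_int_iff)
  hence "int p dvd int (g ^ (3 * k)) - 1" by (simp add: cong_iff_dvd_diff)
  also have "int (g ^ (3 * k)) = h ^ 3" by (simp add: h_def power_mult[symmetric] mult.commute)
  also have "h ^ 3 - 1 = (h - 1) * (h\<^sup>2 + h + 1)" by (simp add: power2_eq_square power3_eq_cube algebra_simps)
  finally have "int p dvd h - 1 \<or> int p dvd h\<^sup>2 + h + 1" using p prime_dvd_mult_iff[of "int p"] by simp
  moreover have "\<not> int p dvd h - 1"
  proof
    assume "int p dvd h - 1"
    hence "[int (g ^ k) = int 1] (mod int p)" by (simp add: cong_iff_dvd_diff h_def)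
    thus False using 1 by (simp only: cong_int_iff)
  qed
  ultimately show ?thesis by blast
qed

text \<open>Pigeonhole: with k the integer square root of p, the square
  \<open>{0..k} \<times> {0..k}\<close> has more than p points, so two of them share the residue of
  u - z v. Their difference has coordinates of size at most k, and \<open>k\<^sup>2 < p\<close>
  strictly since a prime is not a square.\<close>

lemma thue_lemma:
  fixes p :: nat and z :: int
  assumes p: "prime p"
  obtains x y :: int where "(x, y) \<noteq> (0, 0)" "x\<^sup>2 < int p" "y\<^sup>2 < int p" "int p dvd x - z * y"
proof -
  define k where "k = floor_sqrt p"
  have k: "k\<^sup>2 < p" "p < (k + 1)\<^sup>2"
  proof -
    have "k\<^sup>2 \<le> p" unfolding k_def by simp
    moreover have "k\<^sup>2 \<noteq> p" using p by (metis prime_power_iff one_neq_zero numeral_eq_one_iff semiring_norm(85))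
    ultimately show "k\<^sup>2 < p" by simp
    show "p < (k + 1)\<^sup>2" unfolding k_def using Suc_floor_sqrt_power2_gt[of p] by simp
  qed
  define f where "f = (\<lambda>(u, v). (int u - z * int v) mod int p)"
  let ?D = "{0..k} \<times> {0..k}"
  have "f ` ?D \<subseteq> {0..<int p}" using p prime_gt_0_nat by (auto simp: f_def)
  hence "card (f ` ?D) \<le> p" using card_mono[of "{0..<int p}" "f ` ?D"] by simp
  also have "p < card ?D" using k by (simp add: power2_eq_square)
  finally have "\<not> inj_on f ?D" using card_image by fastforce
  then obtain u v u' v' where uv: "u \<le> k" "v \<le> k" "u' \<le> k" "v' \<le> k" "(u, v) \<noteq> (u', v')" "f (u, v) = f (u', v')"
    by (auto simp: inj_on_def)
  have sq: "(int a - int b)\<^sup>2 < int p" if "a \<le> k" "b \<le> k" for a b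
  proof -
    have "\<bar>int a - int b\<bar> \<le> \<bar>int k\<bar>" using that by linarith
    hence "(int a - int b)\<^sup>2 \<le> (int k)\<^sup>2" by (simp only: abs_le_square_iff)
    also have "\<dots> < int p" using k by (metis of_nat_less_iff of_nat_power)
    finally show ?thesis .
  qed
  have "[int u - z * int v = int u' - z * int v'] (mod int p)" using uv(6) by (simp add: f_def cong_def)
  hence "int p dvd (int u - int u') - z * (int v - int v')" by (simp add: cong_iff_dvd_diff algebra_simps)
  with sq uv show ?thesis by (intro that[of "int u - int u'" "int v - int v'"]) auto
qed

text \<open>With z a root of \<open>z\<^sup>2 + z + 1\<close> modulo p, the small vector from
  \<open>thue_lemma\<close> has norm divisible by p, positive and below 3p. Norm 2p is excluded: an
  even norm forces both coordinates to be even, so p would be even.\<close>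

lemma split_prime_is_norm:
  assumes p: "prime p" "[p = 1] (mod 3)"
  obtains c d where "c\<^sup>2 + c * d + d\<^sup>2 = int p"
proof -
  obtain z where z: "int p dvd z\<^sup>2 + z + 1" using ex_cube_root_of_unity[OF p] by blast
  obtain x y where xy: "(x, y) \<noteq> (0, 0)" "x\<^sup>2 < int p" "y\<^sup>2 < int p" "int p dvd x - z * y"
    using thue_lemma[OF p(1)] .
  let ?N = "x\<^sup>2 + x * y + y\<^sup>2"
  have "?N = (x - z * y) * (x + z * y + y) + y\<^sup>2 * (z\<^sup>2 + z + 1)"
    by (simp add: power2_eq_square algebra_simps)
  hence "int p dvd ?N" using z xy(4) by (metis dvd_add dvd_mult dvd_mult2)
  then obtain m where m: "?N = int p * m" by (auto simp: dvd_def)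
  have pp: "int p > 0" using p prime_gt_0_nat by simp
  have "2 * ?N = (x + y)\<^sup>2 + x\<^sup>2 + y\<^sup>2" by (simp add: power2_eq_square algebra_simps)
  moreover have "x\<^sup>2 + y\<^sup>2 > 0" using xy(1) by (simp add: sum_power2_gt_zero_iff)
  moreover have "(x + y)\<^sup>2 \<ge> 0" by simp
  ultimately have "2 * ?N > 0" by (metis add.assoc add_nonneg_pos)
  hence "?N > 0" by simp
  hence m0: "m > 0" using m pp by (simp add: zero_less_mult_iff)
  have "2 * (x * y) \<le> x\<^sup>2 + y\<^sup>2" using zero_le_power2[of "x - y"] by (simp add: power2_eq_square algebra_simps)
  hence "?N < int p * 3" using xy by linarith
  hence "m < 3" using m pp by simp
  with m0 have "m = 1 \<or> m = 2" by auto
  moreover have "m \<noteq> 2"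
  proof
    assume "m = 2"
    with m have N: "?N = 2 * int p" by simp
    hence "even ?N" by simp
    hence "even x" "even y" by auto
    then obtain u v where [simp]: "x = 2 * u" "y = 2 * v" by (auto elim!: evenE)
    have "2 * (u\<^sup>2 + u * v + v\<^sup>2) = int p" using N by (simp add: power2_eq_square algebra_simps)
    hence "even p" by (metis dvd_triv_left even_of_nat)
    hence "p = 2" using p primes_dvd_imp_eq two_is_prime_nat by blast
    thus False using p by (simp add: cong_def)
  qed
  ultimately show ?thesis using m that by simp
qed

text \<open>The prime p is the product of an element of norm p and its conjugate. Multiplication by
  either embeds the solutions for n into those for p n; the two images cover everything and overlap
  exactly in the solutions divisible by p.\<close>

lemma card_eis_reps_split_prime_mult:
  assumes p: "prime p" "[p = 1] (mod 3)"
  shows "card (eis_reps (p * n)) +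
    card {(x, y) \<in> eis_reps (p * n). int p dvd x \<and> int p dvd y} = 2 * card (eis_reps n)"
proof -
  obtain c d where cd: "c\<^sup>2 + c * d + d\<^sup>2 = int p" using split_prime_is_norm[OF p] .
  have pp: "int p > 0" using p prime_gt_0_nat by simp
  have pr: "prime (int p)" using p by simp
  have nsq: False if "int p dvd c" "int p dvd d"
  proof -
    from that obtain u v where [simp]: "c = int p * u" "d = int p * v" by (auto simp: dvd_def)
    have "int p * (int p * (u\<^sup>2 + u * v + v\<^sup>2)) = int p * 1" using cd by (simp add: power2_eq_square algebra_simps)
    hence "int p * (u\<^sup>2 + u * v + v\<^sup>2) = 1" using pp by (simp only: mult_cancel_left) simp
    hence "int p dvd 1" by (metis dvd_triv_left)
    thus False using pr not_prime_unit by blast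
  qed
  have nd: "\<not> int p dvd d"
  proof
    assume d: "int p dvd d"
    have "c\<^sup>2 = int p - d * (c + d)" using cd by (simp add: power2_eq_square algebra_simps)
    hence "int p dvd c\<^sup>2" using d by simp
    thus False using nsq d pr prime_dvd_power by blast
  qed
  have p3: "\<not> int p dvd 3"
  proof
    assume "int p dvd 3"
    hence "p dvd 3" by presburger
    hence "p = 3" using p(1) primes_dvd_imp_eq[of p 3] by simp
    thus False using p by (simp add: cong_def)
  qed
  \<comment> \<open>This is the trace of \<open>c + d \<zeta>\<close>; its square plus
    \<open>3 * d\<^sup>2\<close> is 4p. Its invertibility modulo p is what makes an element of both
    images divisible by p.\<close>
  have ncd: "\<not> int p dvd c + (c + d)"
  proof
    assume a: "int p dvd c + (c + d)"
    have eq: "3 * d\<^sup>2 = 4 * int p - (c + (c + d)) * (c + (c + d))"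
      unfolding cd[symmetric] by (simp add: power2_eq_square algebra_simps)
    have "int p dvd 3 * d\<^sup>2" unfolding eq by (intro dvd_diff dvd_mult a dvd_refl)
    thus False using pr p3 nd by (metis prime_dvd_mult_iff prime_dvd_power)
  qed
  \<comment> \<open>multiplication by \<open>c + d \<zeta>\<close> and by its conjugate, where \<open>\<zeta>\<^sup>2 = \<zeta> - 1\<close>\<close>
  define f where "f = (\<lambda>(x, y). (c * x - d * y, c * y + d * x + d * y))"
  define g where "g = (\<lambda>(x, y). ((c + d) * x + d * y, c * y - d * x))"
  have fg: "f (g (x, y)) = (int p * x, int p * y)" "g (f (x, y)) = (int p * x, int p * y)" for x y
    unfolding cd[symmetric] f_def g_def by (simp_all add: power2_eq_square algebra_simps)
  have inj: "inj f" "inj g"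
  proof -
    have "z = w" if "f z = f w \<or> g z = g w" for z w
    proof -
      obtain x y u v where [simp]: "z = (x, y)" "w = (u, v)" by (cases z, cases w)
      from that have "g (f z) = g (f w) \<or> f (g z) = f (g w)" by auto
      thus ?thesis using pp by (simp add: fg)
    qed
    thus "inj f" "inj g" by (blast intro: injI)+
  qed
  have norm_f: "f (x, y) \<in> eis_reps (p * n) \<longleftrightarrow> (x, y) \<in> eis_reps n"
    and norm_g: "g (x, y) \<in> eis_reps (p * n) \<longleftrightarrow> (x, y) \<in> eis_reps n" for x y
  proof -
    have "(c * x - d * y)\<^sup>2 + (c * x - d * y) * (c * y + d * x + d * y) + (c * y + d * x + d * y)\<^sup>2
        = int p * (x\<^sup>2 + x * y + y\<^sup>2)"
      unfolding cd[symmetric] by (simp add: power2_eq_square algebra_simps)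
    thus "f (x, y) \<in> eis_reps (p * n) \<longleftrightarrow> (x, y) \<in> eis_reps n"
      using pp by (simp add: eis_reps_iff f_def)
    have "((c + d) * x + d * y)\<^sup>2 + ((c + d) * x + d * y) * (c * y - d * x) + (c * y - d * x)\<^sup>2
        = int p * (x\<^sup>2 + x * y + y\<^sup>2)"
      unfolding cd[symmetric] by (simp add: power2_eq_square algebra_simps)
    thus "g (x, y) \<in> eis_reps (p * n) \<longleftrightarrow> (x, y) \<in> eis_reps n"
      using pp by (simp add: eis_reps_iff g_def)
  qed
  \<comment> \<open>One linear congruence detects the image of \<open>f\<close>: it is the second
    coordinate of \<open>g\<close>, and the first one follows because d is invertible modulo p. Then
    \<open>g (x, y)\<close> is p times a vector, that is, \<open>g (f (u, v))\<close>, and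
    \<open>g\<close> is injective.\<close>
  have range_f: "(x, y) \<in> range f \<longleftrightarrow> int p dvd c * y - d * x" for x y
  proof
    assume "(x, y) \<in> range f"
    then obtain u v where "(x, y) = f (u, v)" by auto
    hence "g (x, y) = (int p * u, int p * v)" using fg by simp
    thus "int p dvd c * y - d * x" by (simp add: g_def)
  next
    assume a: "int p dvd c * y - d * x"
    have "d * ((c + d) * x + d * y) = int p * y - (c + d) * (c * y - d * x)"
      unfolding cd[symmetric] by (simp add: power2_eq_square algebra_simps)
    hence "int p dvd d * ((c + d) * x + d * y)" using a by simp
    hence "int p dvd (c + d) * x + d * y" using nd pr by (simp add: prime_dvd_mult_iff)
    with a obtain u v where "g (x, y) = (int p * u, int p * v)" by (auto simp: g_def dvd_def)
    hence "g (x, y) = g (f (u, v))" using fg by simp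
    hence "(x, y) = f (u, v)" using inj by (simp add: inj_eq)
    thus "(x, y) \<in> range f" by blast
  qed
  have range_g: "(x, y) \<in> range g \<longleftrightarrow> int p dvd c * y + d * x + d * y" for x y
  proof
    assume "(x, y) \<in> range g"
    then obtain u v where "(x, y) = g (u, v)" by auto
    hence "f (x, y) = (int p * u, int p * v)" using fg by simp
    thus "int p dvd c * y + d * x + d * y" by (simp add: f_def)
  next
    assume a: "int p dvd c * y + d * x + d * y"
    have "d * (c * x - d * y) = c * (c * y + d * x + d * y) - int p * y"
      unfolding cd[symmetric] by (simp add: power2_eq_square algebra_simps)
    hence "int p dvd d * (c * x - d * y)" using a by simp
    hence "int p dvd c * x - d * y" using nd pr by (simp add: prime_dvd_mult_iff)
    with a obtain u v where "f (x, y) = (int p * u, int p * v)" by (auto simp: f_def dvd_def)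
    hence "f (x, y) = f (g (u, v))" using fg by simp
    hence "(x, y) = g (u, v)" using inj by (simp add: inj_eq)
    thus "(x, y) \<in> range g" by blast
  qed
  have img: "z \<in> range f \<Longrightarrow> z \<in> eis_reps (p * n) \<Longrightarrow> z \<in> f ` eis_reps n"
    "z \<in> range g \<Longrightarrow> z \<in> eis_reps (p * n) \<Longrightarrow> z \<in> g ` eis_reps n" for z
    by (auto simp: norm_f norm_g)
  have un: "f ` eis_reps n \<union> g ` eis_reps n = eis_reps (p * n)"
  proof (intro equalityI subsetI)
    fix z assume z: "z \<in> eis_reps (p * n)"
    obtain x y where [simp]: "z = (x, y)" by (cases z)
    have "x\<^sup>2 + x * y + y\<^sup>2 = int p * int n" using z by (simp add: eis_reps_iff)
    \<comment> \<open>The product of the two linear forms detecting the images is a multiple of the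
      norm modulo p, so primality of p selects one of the images.\<close>
    moreover have "(c * y - d * x) * (c * y + d * x + d * y) = int p * y\<^sup>2 - d\<^sup>2 * (x\<^sup>2 + x * y + y\<^sup>2)"
      unfolding cd[symmetric] by (simp add: power2_eq_square algebra_simps)
    ultimately have "int p dvd (c * y - d * x) * (c * y + d * x + d * y)" by simp
    hence "z \<in> range f \<or> z \<in> range g" using pr by (simp add: prime_dvd_mult_iff range_f range_g)
    thus "z \<in> f ` eis_reps n \<union> g ` eis_reps n" using z img by blast
  qed (auto simp: norm_f norm_g)
  have int: "f ` eis_reps n \<inter> g ` eis_reps n = {(x, y) \<in> eis_reps (p * n). int p dvd x \<and> int p dvd y}"
  proof (intro equalityI subsetI)
    fix z assume z: "z \<in> f ` eis_reps n \<inter> g ` eis_reps n"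
    obtain x y where [simp]: "z = (x, y)" by (cases z)
    have 1: "int p dvd c * y - d * x" "int p dvd c * y + d * x + d * y"
      using z unfolding range_f[symmetric] range_g[symmetric] by auto
    have "(c + (c + d)) * y = (c * y - d * x) + (c * y + d * x + d * y)" by (simp add: algebra_simps)
    hence "int p dvd (c + (c + d)) * y" using dvd_add[OF 1] by metis
    hence y: "int p dvd y" using ncd pr by (simp add: prime_dvd_mult_iff)
    have "d * x = c * y - (c * y - d * x)" by simp
    hence "int p dvd d * x" using 1 y by (metis dvd_diff dvd_mult)
    hence "int p dvd x" using nd pr by (simp add: prime_dvd_mult_iff)
    moreover have "z \<in> eis_reps (p * n)" using z un by blast
    ultimately show "z \<in> {(x, y) \<in> eis_reps (p * n). int p dvd x \<and> int p dvd y}" using y by simp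
  next
    fix z assume z: "z \<in> {(x, y) \<in> eis_reps (p * n). int p dvd x \<and> int p dvd y}"
    obtain x y where [simp]: "z = (x, y)" by (cases z)
    have "z \<in> range f" "z \<in> range g" "z \<in> eis_reps (p * n)" using z by (auto simp: range_f range_g)
    thus "z \<in> f ` eis_reps n \<inter> g ` eis_reps n" using img by blast
  qed
  have "card (f ` eis_reps n) = card (eis_reps n)" "card (g ` eis_reps n) = card (eis_reps n)"
    using inj by (auto intro!: card_image intro: inj_on_subset)
  thus ?thesis using card_Un_Int[of "f ` eis_reps n" "g ` eis_reps n"] finite_eis_reps by (simp add: un int)
qed

text \<open>Second differences in the exponent vanish, so the count is linear in k. At exponent 1
  the overlap is empty because \<open>p\<^sup>2\<close> does not divide p m.\<close>

lemma card_eis_reps_split: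
  assumes p: "prime p" "[p = 1] (mod 3)" and m: "\<not> p dvd m"
  shows "card (eis_reps (p ^ k * m)) = (k + 1) * card (eis_reps m)"
proof (induction k rule: less_induct)
  case (less k)
  consider "k = 0" | "k = 1" | j where "k = j + 2" 
    by (metis One_nat_def add_2_eq_Suc' not0_implies_Suc)
  thus ?case
  proof cases
    case 2
    have none: "{(x, y) \<in> eis_reps (p * m). int p dvd x \<and> int p dvd y} = {}"
    proof (rule ccontr)
      assume "{(x, y) \<in> eis_reps (p * m). int p dvd x \<and> int p dvd y} \<noteq> {}"
      then obtain u v where uv: "(int p * u, int p * v) \<in> eis_reps (p * m)" by (auto simp: dvd_def)
      have "int p * (int p * (u\<^sup>2 + u * v + v\<^sup>2)) = int p * int m"
        using uv by (simp add: eis_reps_iff power2_eq_square algebra_simps)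
      hence "int p * (u\<^sup>2 + u * v + v\<^sup>2) = int m" using p by simp
      hence "int p dvd int m" by (metis dvd_triv_left)
      with m show False by simp
    qed
    show ?thesis using 2 card_eis_reps_split_prime_mult[OF p, of m] unfolding none by simp
  next
    case 3
    have sq: "p * (p ^ Suc j * m) = p\<^sup>2 * (p ^ j * m)" by (simp add: power2_eq_square)
    have "card (eis_reps (p\<^sup>2 * (p ^ j * m))) + card (eis_reps (p ^ j * m)) =
        2 * card (eis_reps (p ^ Suc j * m))"
      using card_eis_reps_split_prime_mult[OF p, of "p ^ Suc j * m"] p(1)
      unfolding sq by (simp add: card_eis_reps_scaled prime_gt_0_nat)
    moreover have "p ^ k * m = p\<^sup>2 * (p ^ j * m)" using 3 by (simp add: power2_eq_square)
    moreover have "card (eis_reps (p ^ j * m)) = (j + 1) * card (eis_reps m)"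
      "card (eis_reps (p ^ Suc j * m)) = (j + 2) * card (eis_reps m)"
      using less[of j] less[of "Suc j"] 3 by simp_all
    ultimately have "card (eis_reps (p ^ k * m)) + (j + 1) * card (eis_reps m) =
        2 * ((j + 2) * card (eis_reps m))"
      by (simp only:)
    thus ?thesis using 3 by (simp add: algebra_simps)
  qed auto
qed

section \<open>Evaluation of the number of solutions by multiplicativity\<close>

text \<open>Peels off a full prime power at a time, so that the cofactor is prime to p, as the
  counts for inert and split primes require.\<close>

lemma prime_power_coprime_induct [consumes 1, case_names one prime_power_mult]:
  fixes n :: nat
  assumes "n > 0" and "P 1"
    and "\<And>p k m. prime p \<Longrightarrow> k > 0 \<Longrightarrow> m > 0 \<Longrightarrow> \<not> p dvd m \<Longrightarrow> P m \<Longrightarrow> P (p ^ k * m)"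
  shows "P n"
  using assms(1)
proof (induction n rule: less_induct)
  case (less n)
  show ?case
  proof (cases "n = 1")
    case False
    then obtain p where p: "prime p" "p dvd n" using prime_factor_nat by blast
    obtain m where m: "n = p ^ multiplicity p n * m" "\<not> p dvd m"
      by (rule multiplicity_decompose'[of n p]) (use less.prems p in auto)
    have k: "multiplicity p n > 0" using p less.prems by (simp add: prime_multiplicity_gt_zero_iff)
    have m0: "m > 0" using m less.prems by (cases m) auto
    have "p ^ multiplicity p n > 1" using k p(1) prime_gt_1_nat one_less_power by blast
    hence "m < n" using m(1) m0 by (metis mult_less_cancel2 mult_1)
    hence "P m" using less.IH m0 by simp
    thus ?thesis using assms(3)[OF p(1) k m0 m(2)] m(1) by simp
  qed (use assms in simp)
qed

lemma multiplicity_prime_power_mult: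
  fixes p q m k :: nat
  assumes "prime p" "prime q" "m > 0" "\<not> p dvd m"
  shows "multiplicity q (p ^ k * m) = (if q = p then k else multiplicity q m)"
  using assms
  by (auto simp: prime_elem_multiplicity_mult_distrib multiplicity_distinct_prime_power
      not_dvd_imp_multiplicity_0 prime_gt_0_nat)

lemma prod_prime_factors_prime_power_mult:
  fixes w :: "nat \<Rightarrow> nat \<Rightarrow> real"
  assumes "prime p" "k > 0" "m > 0" "\<not> p dvd m"
  shows "(\<Prod>q\<in>prime_factors (p ^ k * m). w q (multiplicity q (p ^ k * m))) =
    w p k * (\<Prod>q\<in>prime_factors m. w q (multiplicity q m))"
proof -
  have "prime_factors (p ^ k * m) = insert p (prime_factors m)"
    using assms by (auto simp: prime_factorization_mult prime_factorization_prime_power prime_gt_0_nat)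
  moreover have "p \<notin> prime_factors m" using assms by auto
  moreover have "(\<Prod>q\<in>prime_factors m. w q (multiplicity q (p ^ k * m))) = (\<Prod>q\<in>prime_factors m. w q (multiplicity q m))"
  proof (rule prod.cong)
    fix q assume "q \<in> prime_factors m"
    hence "prime q" "q \<noteq> p" using assms by auto
    thus "w q (multiplicity q (p ^ k * m)) = w q (multiplicity q m)"
      using assms by (simp add: multiplicity_prime_power_mult)
  qed simp
  ultimately show ?thesis using assms by (simp add: multiplicity_prime_power_mult)
qed

text \<open>The local factor of \<open>Lam\<close>. Giving 3 and 5 the value 1 lets a single product
  over all prime factors replace the two restricted ones.\<close>

definition Lam_factor :: "nat \<Rightarrow> nat \<Rightarrow> real" where
  "Lam_factor p k = (if [p = 1] (mod 3) then 1 + real k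
     else if p \<noteq> 5 \<and> [p = 2] (mod 3) then (1 + (-1) ^ k) / 2 else 1)"

lemma Lam_conv_prod: "Lam n = (\<Prod>p\<in>prime_factors n. Lam_factor p (multiplicity p n))"
  unfolding Lam_def
  by (subst (1 2) prod.inter_filter, simp, simp, subst prod.distrib[symmetric], rule prod.cong)
     (auto simp: Lam_factor_def cong_def)

lemma Lam_prime_power_mult:
  assumes "prime p" "m > 0" "\<not> p dvd m"
  shows "Lam (p ^ k * m) = Lam_factor p k * Lam m"
proof (cases "k = 0")
  case True
  thus ?thesis by (simp add: Lam_factor_def)
next
  case False
  thus ?thesis using prod_prime_factors_prime_power_mult[of p k m Lam_factor] assms
    by (simp add: Lam_conv_prod)
qed

lemma prime_mod_3_cases:
  assumes "prime (p :: nat)"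
  obtains "p = 3" | "[p = 1] (mod 3)" | "[p = 2] (mod 3)"
proof -
  have "p mod 3 = 0 \<or> p mod 3 = 1 \<or> p mod 3 = 2" by auto
  moreover have "p = 3" if "p mod 3 = 0"
    using that assms primes_dvd_imp_eq[of 3 p] by (simp add: mod_eq_0_iff_dvd)
  ultimately show ?thesis using that by (auto simp: cong_def)
qed

lemma card_eis_reps_3_power_mult: "card (eis_reps (3 ^ k * m)) = card (eis_reps m)"
  by (induction k) (simp_all add: card_eis_reps_3_mult mult.assoc)

text \<open>A prime power changes both sides by the same factor. The prime 5 is inert as well, but
  \<open>Lam\<close> omits it, so the parity of its exponent enters separately.\<close>

lemma card_eis_reps:
  assumes "n > 0"
  shows "real (card (eis_reps n)) = (if odd (multiplicity 5 n) then 0 else 6 * Lam n)"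
  using assms
proof (induction n rule: prime_power_coprime_induct)
  case one
  show ?case using card_eis_reps_1 by (simp add: Lam_def)
next
  case (prime_power_mult p k m)
  have "prime (5 :: nat)" by simp
  note eqs = multiplicity_prime_power_mult[OF prime_power_mult(1) this prime_power_mult(3,4), of k]
    Lam_prime_power_mult[OF prime_power_mult(1,3,4), of k]
  from prime_power_mult(1) show ?case
  proof (cases p rule: prime_mod_3_cases)
    case 1
    thus ?thesis unfolding eqs using prime_power_mult.IH by (simp add: card_eis_reps_3_power_mult Lam_factor_def cong_def)
  next
    case 2
    hence "p \<noteq> 5" by (auto simp: cong_def)
    thus ?thesis unfolding eqs using prime_power_mult.IH card_eis_reps_split[OF prime_power_mult(1) 2 prime_power_mult(4), of k] 2
      by (simp add: Lam_factor_def algebra_simps)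
  next
    case 3
    hence n1: "\<not> [p = 1] (mod 3)" by (auto simp: cong_def)
    show ?thesis
    proof (cases "p = 5")
      case True
      hence "multiplicity 5 m = 0" using prime_power_mult(4) by (simp add: not_dvd_imp_multiplicity_0)
      thus ?thesis unfolding eqs using prime_power_mult.IH card_eis_reps_inert[OF prime_power_mult(1) 3 prime_power_mult(4), of k] n1 True
        by (simp add: Lam_factor_def)
    next
      case False
      thus ?thesis unfolding eqs using prime_power_mult.IH card_eis_reps_inert[OF prime_power_mult(1) 3 prime_power_mult(4), of k] n1 3
        by (simp add: Lam_factor_def split: if_splits)
    qed
  qed
qed

section \<open>The quadratic character modulo 5\<close>

lemma num_pf_7_13_prime_power_mult:
  assumes "prime p" "m > 0"
  shows "num_pf_7_13 (p ^ k * m) =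
    (if [p = 7] (mod 15) \<or> [p = 13] (mod 15) then k else 0) + num_pf_7_13 m"
proof -
  have "size {#q \<in># replicate_mset k p. P q#} = (if P p then k else 0)" for P
    by (induction k) auto
  thus ?thesis using assms unfolding num_pf_7_13_def
    by (simp add: prime_factorization_mult prime_factorization_prime_power prime_gt_0_nat)
qed

text \<open>By Euler's criterion the square of n modulo 5 is its quadratic character, which is
  multiplicative. The prime 3 has character -1; a prime congruent to 1 modulo 3 has character -1
  exactly in the classes 7 and 13 modulo 15; the other primes occur to even powers because
  \<open>Lam n\<close> is nonzero.\<close>

lemma square_mod_5_eq_genus_sign:
  assumes "n > 0" "\<not> 5 dvd n" "Lam n \<noteq> 0"
  shows "[(int n)\<^sup>2 = (-1) ^ (multiplicity 3 n + num_pf_7_13 n)] (mod 5)"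
  using assms
proof (induction n rule: prime_power_coprime_induct)
  case one
  show ?case by (simp add: num_pf_7_13_def)
next
  case (prime_power_mult p k m)
  note p = \<open>prime p\<close>
  \<comment> \<open>The contribution of \<open>p ^ k\<close> to the exponent of the sign.\<close>
  define s where "s = (if p = 3 \<or> [p = 7] (mod 15) \<or> [p = 13] (mod 15) then k else 0)"
  have p5: "p \<noteq> 5" using prime_power_mult.prems prime_power_mult.hyps(2) by (metis dvd_mult2 dvd_power)
  have lam: "Lam_factor p k \<noteq> 0" "Lam m \<noteq> 0"
    using prime_power_mult.prems Lam_prime_power_mult[OF prime_power_mult.hyps(1,3,4), of k] by auto
  have IH: "[(int m)\<^sup>2 = (-1) ^ (multiplicity 3 m + num_pf_7_13 m)] (mod 5)"
    using prime_power_mult.IH prime_power_mult.prems lam dvd_mult by blast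
  have e: "multiplicity 3 (p ^ k * m) + num_pf_7_13 (p ^ k * m) = s + (multiplicity 3 m + num_pf_7_13 m)"
    using prime_power_mult.hyps
    by (auto simp: s_def multiplicity_prime_power_mult num_pf_7_13_prime_power_mult cong_def
        not_dvd_imp_multiplicity_0)
  have n5: "p mod 5 \<noteq> 0" using p p5 primes_dvd_imp_eq[of 5 p] by (auto simp: mod_eq_0_iff_dvd)
  have mods: "p mod 3 = p mod 15 mod 3" "p mod 5 = p mod 15 mod 5" by (simp_all add: mod_mod_cancel)
  have sq: "[(int p)\<^sup>2 = int (p mod 5) ^ 2] (mod 5)" by (simp add: cong_def zmod_int power_mod)
  have "[((int p)\<^sup>2) ^ k = (-1) ^ s] (mod 5)"
    using p
  proof (cases p rule: prime_mod_3_cases)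
    case 1
    have "[(9 :: int) = -1] (mod 5)" by (simp add: cong_def)
    thus ?thesis using 1 cong_pow[of 9 "-1 :: int" 5 k] by (simp add: s_def)
  next
    case 2
    have p3: "p \<noteq> 3" "p mod 3 = 1" using 2 by (auto simp: cong_def)
    show ?thesis
    proof (cases "[p = 7] (mod 15) \<or> [p = 13] (mod 15)")
      case True
      hence "p mod 5 = 2 \<or> p mod 5 = 3" using mods by (auto simp: cong_def)
      hence "[(int p)\<^sup>2 = -1] (mod 5)" using sq by (auto simp: cong_def)
      thus ?thesis using True by (simp add: s_def cong_pow)
    next
      case False
      have "p mod 15 \<in> {..<15}" by simp
      hence "p mod 15 \<in> {0, 1, 2, 3, 4, 5, 6, 7, 8, 9, 10, 11, 12, 13, 14}"
        by (simp add: lessThan_nat_numeral lessThan_Suc) blast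
      hence "p mod 5 = 1 \<or> p mod 5 = 4" using False p3 n5 mods by (auto simp: cong_def)
      hence "[(int p)\<^sup>2 = 1] (mod 5)" using sq by (auto simp: cong_def)
      thus ?thesis using False p3 cong_pow[of "(int p)\<^sup>2" 1 5 k] by (simp add: s_def)
    qed
  next
    case 3
    have "p \<noteq> 3" "\<not> [p = 1] (mod 3)" "\<not> [p = 7] (mod 15)" "\<not> [p = 13] (mod 15)"
      using 3 mods by (auto simp: cong_def)
    moreover from this have "even k" using lam(1) 3 p5 by (cases "even k") (auto simp: Lam_factor_def)
    then obtain j where j: "k = 2 * j" by (auto elim: evenE)
    have "p mod 5 \<in> {1, 2, 3, 4}" using n5 by auto
    hence "[((int p)\<^sup>2)\<^sup>2 = 1] (mod 5)" using cong_pow[OF sq, of 2] by (auto simp: cong_def)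
    hence "[(((int p)\<^sup>2)\<^sup>2) ^ j = 1] (mod 5)" using cong_pow[of "((int p)\<^sup>2)\<^sup>2" 1 5 j] by simp
    ultimately show ?thesis unfolding j power_mult by (simp add: s_def)
  qed
  hence "[((int p)\<^sup>2) ^ k * (int m)\<^sup>2 = (-1) ^ s * (-1) ^ (multiplicity 3 m + num_pf_7_13 m)] (mod 5)"
    using IH by (rule cong_mult)
  moreover have "(int (p ^ k * m))\<^sup>2 = ((int p)\<^sup>2) ^ k * (int m)\<^sup>2"
    by (simp add: power_mult_distrib power_mult[symmetric] mult.commute)
  ultimately show ?case unfolding e by (simp add: power_add)
qed

section \<open>From the norm form to the two forms of discriminant -75\<close>

text \<open>Setting v = 5y alone would give the form (1,5,25); the shift by 2y in u reduces the
  middle coefficient to 1.\<close>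

lemma num_reps_1_1_19: "num_reps 1 1 19 n = card {(u, v) \<in> eis_reps n. 5 dvd v}"
proof -
  have "bij_betw (\<lambda>(x, y). (x - 2 * y, 5 * y))
      {(x, y). 1 * x\<^sup>2 + 1 * x * y + 19 * y\<^sup>2 = int n} {(u, v) \<in> eis_reps n. 5 dvd v}"
    by (rule bij_betwI[where g = "\<lambda>(u, v). (u + 2 * (v div 5), v div 5)"])
       (auto simp: eis_reps_iff power2_eq_square algebra_simps elim!: dvdE)
  thus ?thesis by (simp add: num_reps_def bij_betw_same_card)
qed

text \<open>Three times the form (3,3,7) at (x, y) is the form (1,1,19) at (3x + y, y). Every
  solution for 3n arises so, because (1,1,19) is congruent to \<open>(x - y)\<^sup>2\<close> modulo
  3.\<close>

lemma num_reps_3_3_7: "num_reps 3 3 7 n = num_reps 1 1 19 (3 * n)"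
proof -
  have 3: "3 dvd x - y" if "x\<^sup>2 + x * y + 19 * y\<^sup>2 = 3 * int n" for x y
  proof -
    have "(x - y)\<^sup>2 = 3 * (int n - x * y - 6 * y\<^sup>2)"
      using that by (simp add: power2_eq_square algebra_simps)
    hence "3 dvd (x - y)\<^sup>2" by simp
    thus ?thesis by (rule prime_dvd_power[rotated]) simp
  qed
  have "bij_betw (\<lambda>(x, y). (3 * x + y, y))
      {(x, y). 3 * x\<^sup>2 + 3 * x * y + 7 * y\<^sup>2 = int n}
      {(x, y). 1 * x\<^sup>2 + 1 * x * y + 19 * y\<^sup>2 = int (3 * n)}"
  proof (rule bij_betwI[where g = "\<lambda>(x, y). ((x - y) div 3, y)"])
    show "(\<lambda>(x, y). ((x - y) div 3, y)) \<in> {(x, y). 1 * x\<^sup>2 + 1 * x * y + 19 * y\<^sup>2 = int (3 * n)}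
        \<rightarrow> {(x, y). 3 * x\<^sup>2 + 3 * x * y + 7 * y\<^sup>2 = int n}"
    proof clarify
      fix x y :: int
      assume e: "1 * x\<^sup>2 + 1 * x * y + 19 * y\<^sup>2 = int (3 * n)"
      then obtain k where k: "x - y = 3 * k" using 3[of x y] by (auto elim: dvdE)
      hence [simp]: "x = 3 * k + y" by simp
      have "3 * (3 * k\<^sup>2 + 3 * k * y + 7 * y\<^sup>2) = 3 * int n"
        using e by (simp add: power2_eq_square algebra_simps)
      thus "3 * ((x - y) div 3)\<^sup>2 + 3 * ((x - y) div 3) * y + 7 * y\<^sup>2 = int n" by simp
    qed
  qed (use 3 in \<open>auto simp: power2_eq_square algebra_simps\<close>)
  thus ?thesis by (simp add: num_reps_def bij_betw_same_card)
qed

text \<open>Of the six lines through the origin modulo 5, the norm takes square values on u = 0, v =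
  0 and u + v = 0, and equals 3, 2, 3 times \<open>u\<^sup>2\<close> on v = u, v = 2u, v = 3u, where
  it is a nonsquare. Distinct lines meet only at the origin, where 5 divides the norm. The proof
  checks all residues.\<close>

lemma eis_form_mod_5:
  fixes u v :: int
  defines "N \<equiv> u\<^sup>2 + u * v + v\<^sup>2"
  assumes "\<not> 5 dvd N"
  shows "[N\<^sup>2 = 1] (mod 5) \<longleftrightarrow> 5 dvd u \<or> 5 dvd v \<or> 5 dvd u + v"
    and "\<not> (5 dvd u \<and> 5 dvd v)" "\<not> (5 dvd u \<and> 5 dvd u + v)" "\<not> (5 dvd v \<and> 5 dvd u + v)"
proof -
  define r s where "r = u mod 5" and "s = v mod 5"
  have "[u = r] (mod 5)" "[v = s] (mod 5)" by (simp_all add: r_def s_def cong_def)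
  hence N: "N mod 5 = (r\<^sup>2 + r * s + s\<^sup>2) mod 5"
    unfolding N_def cong_def[symmetric] by (intro cong_add cong_mult cong_pow)
  have N2: "N\<^sup>2 mod 5 = (r\<^sup>2 + r * s + s\<^sup>2)\<^sup>2 mod 5"
    by (metis N power_mod)
  have us: "(u + v) mod 5 = (r + s) mod 5" unfolding r_def s_def by (simp add: mod_simps)
  have "r \<in> {0, 1, 2, 3, 4}" "s \<in> {0, 1, 2, 3, 4}" unfolding r_def s_def by auto
  thus "[N\<^sup>2 = 1] (mod 5) \<longleftrightarrow> 5 dvd u \<or> 5 dvd v \<or> 5 dvd u + v"
    and "\<not> (5 dvd u \<and> 5 dvd v)" "\<not> (5 dvd u \<and> 5 dvd u + v)" "\<not> (5 dvd v \<and> 5 dvd u + v)"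
    using assms(2) unfolding cong_def dvd_eq_mod_eq_0 N N2 us r_def[symmetric] s_def[symmetric]
    by auto
qed

text \<open>The set \<open>V\<close> counted by (1,1,19) is one of three disjoint sets of equal
  size, whose union is everything or empty. The factor 3 on the left avoids division of natural
  numbers.\<close>

lemma num_reps_1_1_19_coprime_5:
  assumes n: "\<not> 5 dvd n"
  shows "3 * num_reps 1 1 19 n = (if [(int n)\<^sup>2 = 1] (mod 5) then card (eis_reps n) else 0)"
proof -
  define U V W where "U = {(u, v) \<in> eis_reps n. 5 dvd u}" and "V = {(u, v) \<in> eis_reps n. 5 dvd v}"
    and "W = {(u, v) \<in> eis_reps n. 5 dvd u + v}"
  have n': "\<not> 5 dvd int n" using n by presburger
  have e: "[(int n)\<^sup>2 = 1] (mod 5) \<longleftrightarrow> 5 dvd u \<or> 5 dvd v \<or> 5 dvd u + v"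
    "\<not> (5 dvd u \<and> 5 dvd v)" "\<not> (5 dvd u \<and> 5 dvd u + v)" "\<not> (5 dvd v \<and> 5 dvd u + v)"
    if "(u, v) \<in> eis_reps n" for u v
    using eis_form_mod_5[of u v] that n' unfolding eis_reps_iff by simp_all
  have fin: "finite U" "finite V" "finite W"
    using finite_eis_reps[of n] by (auto simp: U_def V_def W_def intro: rev_finite_subset)
  \<comment> \<open>multiplication by the unit \<open>\<zeta>\<close> with \<open>\<zeta>\<^sup>2 = \<zeta> - 1\<close>\<close>
  have "bij_betw (\<lambda>(u, v). (-v, u + v)) V U"
    by (rule bij_betwI[where g = "\<lambda>(u, v). (u + v, -u)"])
       (auto simp: U_def V_def eis_reps_iff power2_eq_square algebra_simps)
  moreover have "bij_betw (\<lambda>(u, v). (-v, u + v)) U W"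
    by (rule bij_betwI[where g = "\<lambda>(u, v). (u + v, -u)"])
       (auto simp: U_def W_def eis_reps_iff power2_eq_square algebra_simps)
  ultimately have c: "card U = card V" "card W = card V" by (metis bij_betw_same_card)+
  have d: "U \<inter> V = {}" "(U \<union> V) \<inter> W = {}"
    using e(2-4) by (auto simp: U_def V_def W_def)
  have "card (U \<union> V \<union> W) = 3 * card V"
    using d fin c by (simp add: card_Un_disjoint)
  moreover have "U \<union> V \<union> W = (if [(int n)\<^sup>2 = 1] (mod 5) then eis_reps n else {})"
    using e(1) by (auto simp: U_def V_def W_def)
  ultimately show ?thesis unfolding num_reps_1_1_19 V_def[symmetric] by (simp split: if_splits)
qed

text \<open>Since 5 is inert, it divides both coordinates of every solution.\<close>

lemma num_reps_1_1_19_dvd_5: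
  assumes "5 dvd n"
  shows "num_reps 1 1 19 n = card (eis_reps n)"
proof -
  have "5 dvd v" if "(u, v) \<in> eis_reps n" for u v
  proof -
    have "int 5 dvd int n" using assms by (simp only: int_dvd_int_iff)
    thus ?thesis using inert_prime_dvd[of 5 u v] that by (simp add: eis_reps_iff cong_def)
  qed
  hence "{(u, v) \<in> eis_reps n. 5 dvd v} = eis_reps n" by auto
  thus ?thesis by (simp add: num_reps_1_1_19)
qed

lemma num_reps_1_1_19_eq:
  fixes n :: nat
  assumes "n > 0"
  shows "real (num_reps 1 1 19 n) =
    (if multiplicity 5 n = 0 then (1 + (-1) ^ (multiplicity 3 n + num_pf_7_13 n)) * Lam n
     else if odd (multiplicity 5 n) then 0 else 6 * Lam n)"
proof (cases "5 dvd n")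
  case True
  hence "multiplicity 5 n > 0" using assms by (simp add: prime_multiplicity_gt_zero_iff)
  thus ?thesis using card_eis_reps[OF assms] True by (simp add: num_reps_1_1_19_dvd_5)
next
  case False
  define e where "e = multiplicity 3 n + num_pf_7_13 n"
  have m: "multiplicity 5 n = 0" using False by (simp add: not_dvd_imp_multiplicity_0)
  have r: "3 * real (num_reps 1 1 19 n) = (if [(int n)\<^sup>2 = 1] (mod 5) then 6 * Lam n else 0)"
    using arg_cong[OF num_reps_1_1_19_coprime_5[OF False], of real] card_eis_reps[OF assms] m by simp
  show ?thesis
  proof (cases "Lam n = 0")
    case True
    thus ?thesis using r m by (simp split: if_splits)
  next
    case L: False
    have "[(int n)\<^sup>2 = (-1) ^ e] (mod 5)" unfolding e_def by (rule square_mod_5_eq_genus_sign[OF assms False L])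
    hence "[(int n)\<^sup>2 = 1] (mod 5) \<longleftrightarrow> even e"
      by (cases "even e") (auto simp: cong_def)
    thus ?thesis using r m unfolding e_def[symmetric] by (cases "even e") simp_all
  qed
qed

theorem theorem4p2:
  fixes n a b t :: nat
  assumes "n > 0"
    and "a = multiplicity 3 n"
    and "b = multiplicity 5 n"
    and "t = num_pf_7_13 n"
  shows "real (num_reps 1 1 19 n) =
           (if b = 0 then (1 + (-1) ^ (a + t)) * Lam n
            else if odd b then 0
            else 6 * Lam n)
       \<and> real (num_reps 3 3 7 n) =
           (if b = 0 then (1 - (-1) ^ (a + t)) * Lam n
            else if odd b then 0
            else 6 * Lam n)"
proof -
  \<comment> \<open>Passing from n to 3n raises a by one and preserves b, t and \<open>Lam\<close>,
    which flips the sign in the case b = 0.\<close>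
  have "multiplicity 3 (3 * n) = Suc a" "multiplicity 5 (3 * n) = b"
    using assms by (simp_all add: prime_elem_multiplicity_mult_distrib prime_multiplicity_other)
  moreover have "num_pf_7_13 (3 * n) = t"
    using num_pf_7_13_prime_power_mult[of 3 n 1] assms by (simp add: cong_def)
  moreover have "Lam (3 * n) = Lam n"
  proof -
    \<comment> \<open>Since 3 may already divide n, \<open>Lam n\<close> and
      \<open>Lam (3 * n)\<close> are both compared with \<open>Lam m\<close> for the part m of n
      prime to 3.\<close>
    obtain m where m: "n = 3 ^ a * m" "\<not> 3 dvd m"
      using multiplicity_decompose'[of n 3] assms by auto
    have "m > 0" using m assms by (cases m) auto
    thus ?thesis using Lam_prime_power_mult[of 3 m a] Lam_prime_power_mult[of 3 m "Suc a"] m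
      by (simp add: Lam_factor_def cong_def mult.assoc)
  qed
  ultimately show ?thesis
    using num_reps_1_1_19_eq[of n] num_reps_1_1_19_eq[of "3 * n"] assms by (simp add: num_reps_3_3_7)
qed

end
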